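(* For every instance of MLCM-P\_PATH, Algorithm FixLeftEnd outputs an assignment of line ends such that the minimum crossing number of an admissible layout realizing this assignment equals the minimum crossing number of an admissible layout satisfying the periphery condition (i.e. the optimum of MLCM-P\_PATH).
   Context: Stations $1,\dots,n$ lie on a horizontal line, joined by edges $(i,i+1)$. A line is $[s,t]$ with $1\le s<t\le n$, travelling along edges $(s,s+1),\dots,(t-1,t)$; $\mathcal L=\{l_1,\dots,l_m\}$ is a set of pairwise distinct lines, $l_j=[s_j,t_j]$; $\mathcal L_{i,i+1}$ is the set of lines traversing edge $(i,i+1)$; $[a,b]$ passes through station $i$ if $a<i<b$. A layout specifies, for every edge, a top-to-bottom order of its lines at each of its two ends; two lines cross on an edge if their orders differ at the two ends; the crossing number counts (pair, edge) crossings. Admissible: lines passing through station $i$ keep the same relative order at the station-$i$ ends of edges $(i-1,i)$ and $(i,i+1)$. Periphery condition: each line $[a,b]$ is above all or below all lines passing through $a$ at the station-$a$ end of $(a,a+1)$, and likewise at $b$ on $(b-1,b)$; the corresponding value $\uparrow$ (above) or $\downarrow$ (below) is the assignment of that end, and a layout realizes an assignment if each end is positioned accordingly. MLCM-P\_PATH: find an admissible layout satisfying the periphery condition with minimum crossing number. For $l_j$ (values $x_j,y_j$) and $l_k$ with $s_k<t_j<t_k$ (left value $x_k$), say they conflict if ($s_j<s_k$ and $y_j=x_k$) or ($s_j=s_k$, $x_j\ne y_j$ and $x_k=y_j$) or ($s_k<s_j$ and $x_j\ne y_j$). Algorithm FixLeftEnd: for each of the $2^m$ choices of left-end values $x_1,\dots,x_m$,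 for $j=1,\dots,m$ choose $y_j$ minimizing the number of $k$ with $s_k<t_j<t_k$ such that $l_j,l_k$ conflict (ties broken by $\uparrow$); compute the minimum crossing number of an admissible layout realizing the resulting assignment; output an assignment (the first encountered) for which this number is smallest. *)

theory Defs
  imports Main
begin

text \<open>
  An instance consists of the number \<open>n\<close> of stations and a list \<open>ls\<close> of lines \<open>(s, t)\<close>.
  A line is referred to by its index \<open>j < length ls\<close>; edge \<open>i\<close> stands for \<open>(i, i + 1)\<close>.
\<close>

abbreviation lstart :: "(nat \<times> nat) list \<Rightarrow> nat \<Rightarrow> nat" where
  "lstart ls j \<equiv> fst (ls ! j)"

abbreviation lend :: "(nat \<times> nat) list \<Rightarrow> nat \<Rightarrow> nat" where
  "lend ls j \<equiv> snd (ls ! j)"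

definition is_instance :: "nat \<Rightarrow> (nat \<times> nat) list \<Rightarrow> bool" where
  "is_instance n ls \<longleftrightarrow>
     distinct ls \<and> (\<forall>(s, t) \<in> set ls. 1 \<le> s \<and> s < t \<and> t \<le> n)"

definition edge_lines :: "(nat \<times> nat) list \<Rightarrow> nat \<Rightarrow> nat set" where
  "edge_lines ls i = {j. j < length ls \<and> lstart ls j \<le> i \<and> i + 1 \<le> lend ls j}"

definition passing :: "(nat \<times> nat) list \<Rightarrow> nat \<Rightarrow> nat set" where
  "passing ls i = {j. j < length ls \<and> lstart ls j < i \<and> i < lend ls j}"

text \<open>
  The order of the lines at an end of an edge is the list of their indices from top to bottom.
  \<open>at_left lay i\<close> is the order at the station-\<open>i\<close> end and \<open>at_right lay i\<close> the order at the
  station-\<open>(i + 1)\<close> end of edge \<open>(i, i + 1)\<close>.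
\<close>

record layout =
  at_left :: "nat \<Rightarrow> nat list"
  at_right :: "nat \<Rightarrow> nat list"

definition is_layout :: "nat \<Rightarrow> (nat \<times> nat) list \<Rightarrow> layout \<Rightarrow> bool" where
  "is_layout n ls lay \<longleftrightarrow> (\<forall>i \<in> {1..<n}.
     distinct (at_left lay i) \<and> set (at_left lay i) = edge_lines ls i \<and>
     distinct (at_right lay i) \<and> set (at_right lay i) = edge_lines ls i)"

definition above :: "nat list \<Rightarrow> nat \<Rightarrow> nat \<Rightarrow> bool" where
  "above ord j k \<longleftrightarrow> (\<exists>p q. p < q \<and> q < length ord \<and> ord ! p = j \<and> ord ! q = k)"

definition cross_on :: "layout \<Rightarrow> nat \<Rightarrow> nat \<Rightarrow> nat \<Rightarrow> bool" where
  "cross_on lay i j k \<longleftrightarrow> above (at_left lay i) j k \<noteq> above (at_right lay i) j k"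

text \<open>Each unordered pair of lines is counted once, through \<open>j < k\<close>.\<close>

definition crossing_number :: "nat \<Rightarrow> (nat \<times> nat) list \<Rightarrow> layout \<Rightarrow> nat" where
  "crossing_number n ls lay =
     (\<Sum>i \<in> {1..<n}.
        card {(j, k). j \<in> edge_lines ls i \<and> k \<in> edge_lines ls i \<and> j < k \<and> cross_on lay i j k})"

definition admissible :: "nat \<Rightarrow> (nat \<times> nat) list \<Rightarrow> layout \<Rightarrow> bool" where
  "admissible n ls lay \<longleftrightarrow> is_layout n ls lay \<and>
     (\<forall>i \<in> {1<..<n}. \<forall>j \<in> passing ls i. \<forall>k \<in> passing ls i.
        above (at_right lay (i - 1)) j k \<longleftrightarrow> above (at_left lay i) j k)"

datatype side = Up | Down

fun positioned :: "side \<Rightarrow> nat list \<Rightarrow> nat \<Rightarrow> nat set \<Rightarrow> bool" where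
  "positioned Up ord j P \<longleftrightarrow> (\<forall>k \<in> P. above ord j k)"
| "positioned Down ord j P \<longleftrightarrow> (\<forall>k \<in> P. above ord k j)"

definition left_positioned :: "(nat \<times> nat) list \<Rightarrow> layout \<Rightarrow> nat \<Rightarrow> side \<Rightarrow> bool" where
  "left_positioned ls lay j x \<longleftrightarrow>
     positioned x (at_left lay (lstart ls j)) j (passing ls (lstart ls j))"

definition right_positioned :: "(nat \<times> nat) list \<Rightarrow> layout \<Rightarrow> nat \<Rightarrow> side \<Rightarrow> bool" where
  "right_positioned ls lay j y \<longleftrightarrow>
     positioned y (at_right lay (lend ls j - 1)) j (passing ls (lend ls j))"

definition periphery :: "(nat \<times> nat) list \<Rightarrow> layout \<Rightarrow> bool" where
  "periphery ls lay \<longleftrightarrow> (\<forall>j < length ls.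
     (left_positioned ls lay j Up \<or> left_positioned ls lay j Down) \<and>
     (right_positioned ls lay j Up \<or> right_positioned ls lay j Down))"

text \<open>An assignment is a pair of lists: the left-end values and the right-end values, by line index.\<close>

type_synonym assignment = "side list \<times> side list"

definition realizes :: "(nat \<times> nat) list \<Rightarrow> layout \<Rightarrow> assignment \<Rightarrow> bool" where
  "realizes ls lay a \<longleftrightarrow> (\<forall>j < length ls.
     left_positioned ls lay j (fst a ! j) \<and> right_positioned ls lay j (snd a ! j))"

definition min_crossings_realizing :: "nat \<Rightarrow> (nat \<times> nat) list \<Rightarrow> assignment \<Rightarrow> nat" where
  "min_crossings_realizing n ls a =
     (LEAST c. \<exists>lay. admissible n ls lay \<and> realizes ls lay a \<and> crossing_number n ls lay = c)"

definition mlcm_p_path_optimum :: "nat \<Rightarrow> (nat \<times> nat) list \<Rightarrow> nat" where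
  "mlcm_p_path_optimum n ls =
     (LEAST c. \<exists>lay. admissible n ls lay \<and> periphery ls lay \<and> crossing_number n ls lay = c)"

text \<open>
  \<open>conflict ls X j y k\<close>: conflict of line \<open>j\<close>, with right-end value \<open>y\<close>, and a line \<open>k\<close>
  passing through the right end of \<open>j\<close>, under the left-end values \<open>X\<close>.
\<close>

definition conflict :: "(nat \<times> nat) list \<Rightarrow> side list \<Rightarrow> nat \<Rightarrow> side \<Rightarrow> nat \<Rightarrow> bool" where
  "conflict ls X j y k \<longleftrightarrow>
     (lstart ls j < lstart ls k \<and> y = X ! k) \<or>
     (lstart ls j = lstart ls k \<and> X ! j \<noteq> y \<and> X ! k = y) \<or>
     (lstart ls k < lstart ls j \<and> X ! j \<noteq> y)"

definition num_conflicts :: "(nat \<times> nat) list \<Rightarrow> side list \<Rightarrow> nat \<Rightarrow> side \<Rightarrow> nat" where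
  "num_conflicts ls X j y = card {k \<in> passing ls (lend ls j). conflict ls X j y k}"

definition right_value :: "(nat \<times> nat) list \<Rightarrow> side list \<Rightarrow> nat \<Rightarrow> side" where
  "right_value ls X j = (if num_conflicts ls X j Up \<le> num_conflicts ls X j Down then Up else Down)"

definition complete_assignment :: "(nat \<times> nat) list \<Rightarrow> side list \<Rightarrow> assignment" where
  "complete_assignment ls X = (X, map (right_value ls X) [0..<length ls])"

text \<open>
  The list \<open>Xs\<close> gives the order in which the choices of left-end values are tried;
  \<open>arg_min_list\<close> returns the first minimizer in the list.
\<close>

definition fix_left_end :: "nat \<Rightarrow> (nat \<times> nat) list \<Rightarrow> side list list \<Rightarrow> assignment" where
  "fix_left_end n ls Xs =
     arg_min_list (min_crossings_realizing n ls) (map (complete_assignment ls) Xs)"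

end

theory Submission
  imports Defs "HOL-Library.Product_Lexorder"
begin

text \<open>
  Order the lines by the signed depth \<open>- s\<close> (left value \<open>Up\<close>) or \<open>s\<close> (left value \<open>Down\<close>) of
  their left ends, with ties broken by the analogous depth of the right ends. Drawing the lines in
  this order, and moving a line to its prescribed extreme position only on its last edge, realizes
  every assignment. A line ending at \<open>t\<close> then crosses a line passing through \<open>t\<close> only if the two
  conflict, because conflicting with \<open>Up\<close> (\<open>Down\<close>) means that the other line has strictly smaller
  (larger) depth. Two lines that end at the same station do not cross if the right values are chosen
  greedily, since the number of conflicts with \<open>Up\<close> increases and the number of conflicts
  with \<open>Down\<close> decreases with the depth.

  Conversely, take an optimal layout, with the left value \<open>Up\<close> wherever it is possible. Every
  conflict forces a crossing, so the layout has at least as many crossings as there are conflicts,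
  and the greedy right values minimize the number of conflicts line by line.
\<close>

section \<open>Orders given by lists, and basic facts on instances\<close>

lemma above_mem: "above xs j k \<Longrightarrow> j \<in> set xs \<and> k \<in> set xs"
  unfolding above_def by auto

lemma above_trans:
  assumes "distinct xs" "above xs j k" "above xs k l"
  shows "above xs j l"
proof -
  obtain p q where pq: "p < q" "q < length xs" "xs ! p = j" "xs ! q = k"
    using assms(2) unfolding above_def by blast
  obtain p' q' where pq': "p' < q'" "q' < length xs" "xs ! p' = k" "xs ! q' = l"
    using assms(3) unfolding above_def by blast
  have "q = p'"
    using pq pq' assms(1) by (metis nth_eq_iff_index_eq order.strict_trans)
  then show ?thesis
    unfolding above_def using pq pq' by (metis order.strict_trans)
qed

lemma above_irrefl: "distinct xs \<Longrightarrow> \<not> above xs j j"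
  unfolding above_def by (auto simp: nth_eq_iff_index_eq)

lemma above_asym: "distinct xs \<Longrightarrow> above xs j k \<Longrightarrow> \<not> above xs k j"
  using above_trans above_irrefl by blast

lemma above_total:
  "j \<in> set xs \<Longrightarrow> k \<in> set xs \<Longrightarrow> j \<noteq> k \<Longrightarrow> above xs j k \<or> above xs k j"
  by (auto simp: above_def in_set_conv_nth) (metis linorder_neqE_nat)

lemma not_above_iff:
  "distinct xs \<Longrightarrow> j \<in> set xs \<Longrightarrow> k \<in> set xs \<Longrightarrow> j \<noteq> k \<Longrightarrow> \<not> above xs j k \<longleftrightarrow> above xs k j"
  using above_asym above_total by blast

text \<open>An injective key leaves no ties, so the order of the sorted list is exactly the strict
  order of the keys. All vertical orders of the constructed layout are read off in this way.\<close>

lemma above_sort_key_iff: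
  fixes f :: "nat \<Rightarrow> 'a::linorder"
  assumes "distinct xs" "inj_on f (set xs)"
  shows "above (sort_key f xs) j k \<longleftrightarrow> j \<in> set xs \<and> k \<in> set xs \<and> f j < f k"
proof -
  have *: "f j < f k" if ab: "above (sort_key f xs) j k" for j k
  proof -
    obtain p q where "p < q" "q < length (sort_key f xs)"
      "sort_key f xs ! p = j" "sort_key f xs ! q = k"
      using ab unfolding above_def by blast
    then have "f j \<le> f k"
      using sorted_nth_mono[OF sorted_sort_key, of p q f xs] by simp
    moreover have "j \<noteq> k"
      using above_asym[of "sort_key f xs" j k] ab assms(1) by auto
    ultimately show ?thesis
      using above_mem[OF ab] assms(2) by (metis inj_onD order_le_less set_sort)
  qed
  show ?thesis
    using * above_mem[of "sort_key f xs"] above_total[of j "sort_key f xs" k]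
    by (metis less_asym less_irrefl set_sort)
qed

lemma instance_line:
  assumes "is_instance n ls" "j < length ls"
  shows "1 \<le> lstart ls j" "lstart ls j < lend ls j" "lend ls j \<le> n"
  using assms nth_mem[OF assms(2)] unfolding is_instance_def by (auto simp: case_prod_beta)

lemma finite_passing [simp]: "finite (passing ls i)"
  unfolding passing_def by simp

lemma finite_edge_lines [simp]: "finite (edge_lines ls i)"
  unfolding edge_lines_def by simp

section \<open>The layout that draws lines by depth\<close>

definition left_depth :: "(nat \<times> nat) list \<Rightarrow> side list \<Rightarrow> nat \<Rightarrow> int" where
  "left_depth ls X j = (if X ! j = Up then - int (lstart ls j) else int (lstart ls j))"

text \<open>Of two lines with equal left depth, the one ending earlier gets a value strictly on the
  side of its own right value, whatever the right value of the other. Its exit then needs no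
  crossing with the other line.\<close>

definition right_depth :: "nat \<Rightarrow> (nat \<times> nat) list \<Rightarrow> side list \<Rightarrow> nat \<Rightarrow> int" where
  "right_depth n ls Y j = (if Y ! j = Up then int (lend ls j) - int n else int n - int (lend ls j))"

definition depth :: "nat \<Rightarrow> (nat \<times> nat) list \<Rightarrow> assignment \<Rightarrow> nat \<Rightarrow> int \<times> int" where
  "depth n ls a j = (left_depth ls (fst a) j, right_depth n ls (snd a) j)"

text \<open>The leading sort key at the station-\<open>(i + 1)\<close> end of edge \<open>i\<close>:
  it pulls the lines ending there out to the top or bottom and leaves the others in depth
  order.\<close>

definition exit_zone :: "(nat \<times> nat) list \<Rightarrow> assignment \<Rightarrow> nat \<Rightarrow> nat \<Rightarrow> int" where
  "exit_zone ls a i j = (if lend ls j = i + 1 then (if snd a ! j = Up then - 1 else 1) else 0)"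

definition edge_list :: "(nat \<times> nat) list \<Rightarrow> nat \<Rightarrow> nat list" where
  "edge_list ls i = filter (\<lambda>j. j \<in> edge_lines ls i) [0..<length ls]"

definition depth_layout :: "nat \<Rightarrow> (nat \<times> nat) list \<Rightarrow> assignment \<Rightarrow> layout" where
  "depth_layout n ls a =
     \<lparr>at_left = \<lambda>i. sort_key (depth n ls a) (edge_list ls i),
      at_right = \<lambda>i. sort_key (\<lambda>j. (exit_zone ls a i j, depth n ls a j)) (edge_list ls i)\<rparr>"

lemma edge_list [simp]: "distinct (edge_list ls i)" "set (edge_list ls i) = edge_lines ls i"
  unfolding edge_list_def edge_lines_def by auto

text \<open>Since starts are positive and ends are at most \<open>n\<close>, the absolute values of
  the two components recover start and end, and the lines of an instance are distinct.\<close>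

lemma inj_on_depth:
  assumes "is_instance n ls"
  shows "inj_on (depth n ls a) {..<length ls}"
proof (rule inj_onI)
  fix j k assume jk: "j \<in> {..<length ls}" "k \<in> {..<length ls}" "depth n ls a j = depth n ls a k"
  have "lstart ls j = lstart ls k" "lend ls j = lend ls k"
    using jk instance_line[OF assms, of j] instance_line[OF assms, of k]
    by (auto simp: depth_def left_depth_def right_depth_def split: if_splits)
  then have "ls ! j = ls ! k" by (simp add: prod_eq_iff)
  then show "j = k"
    using jk assms by (simp add: is_instance_def nth_eq_iff_index_eq)
qed

lemma above_depth_layout:
  assumes "is_instance n ls"
  shows "above (at_left (depth_layout n ls a) i) j k \<longleftrightarrow>
      j \<in> edge_lines ls i \<and> k \<in> edge_lines ls i \<and> depth n ls a j < depth n ls a k"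
    and "above (at_right (depth_layout n ls a) i) j k \<longleftrightarrow>
      j \<in> edge_lines ls i \<and> k \<in> edge_lines ls i \<and>
      (exit_zone ls a i j, depth n ls a j) < (exit_zone ls a i k, depth n ls a k)"
proof -
  have inj: "inj_on (depth n ls a) (edge_lines ls i)"
    by (rule inj_on_subset[OF inj_on_depth[OF assms]]) (auto simp: edge_lines_def)
  then have inj': "inj_on (\<lambda>j. (exit_zone ls a i j, depth n ls a j)) (edge_lines ls i)"
    by (auto simp: inj_on_def)
  show "above (at_left (depth_layout n ls a) i) j k \<longleftrightarrow>
      j \<in> edge_lines ls i \<and> k \<in> edge_lines ls i \<and> depth n ls a j < depth n ls a k"
    using inj by (simp add: depth_layout_def above_sort_key_iff)
  show "above (at_right (depth_layout n ls a) i) j k \<longleftrightarrow>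
      j \<in> edge_lines ls i \<and> k \<in> edge_lines ls i \<and>
      (exit_zone ls a i j, depth n ls a j) < (exit_zone ls a i k, depth n ls a k)"
    using inj' by (simp add: depth_layout_def above_sort_key_iff)
qed

text \<open>A line passing through station \<open>i\<close> has exit zone 0 on edge
  \<open>i - 1\<close>, so both ends at that station compare passing lines by depth alone.\<close>

lemma admissible_depth_layout:
  assumes "is_instance n ls"
  shows "admissible n ls (depth_layout n ls a)"
proof -
  have "is_layout n ls (depth_layout n ls a)"
    by (simp add: is_layout_def depth_layout_def)
  then show ?thesis
    unfolding admissible_def
    by (auto simp: above_depth_layout[OF assms] exit_zone_def passing_def edge_lines_def)
qed

lemma realizes_depth_layout:
  assumes "is_instance n ls"
  shows "realizes ls (depth_layout n ls a) a"
  unfolding realizes_def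
proof (intro allI impI conjI)
  fix j assume j: "j < length ls"
  note lj = instance_line[OF assms j]
  have edge: "j \<in> edge_lines ls (lstart ls j)" "j \<in> edge_lines ls (lend ls j - 1)"
    using j lj by (auto simp: edge_lines_def)
  show "left_positioned ls (depth_layout n ls a) j (fst a ! j)"
  proof -
    \<comment> \<open>A line passing through the start of \<open>j\<close> starts earlier, so its
      left depth has a strictly smaller absolute value and \<open>j\<close> is extreme on its own
      side.\<close>
    have "k \<in> edge_lines ls (lstart ls j)" and "if fst a ! j = Up
      then depth n ls a j < depth n ls a k else depth n ls a k < depth n ls a j"
      if "k \<in> passing ls (lstart ls j)" for k
      using that by (auto simp: edge_lines_def passing_def depth_def left_depth_def)
    then show ?thesis
      unfolding left_positioned_def using edge
      by (cases "fst a ! j") (auto simp: above_depth_layout[OF assms] simp del: less_prod_simp)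
  qed
  show "right_positioned ls (depth_layout n ls a) j (snd a ! j)"
  proof -
    have "k \<in> edge_lines ls (lend ls j - 1)" and "exit_zone ls a (lend ls j - 1) k = 0"
      if "k \<in> passing ls (lend ls j)" for k
      using that by (auto simp: edge_lines_def passing_def exit_zone_def)
    moreover have "exit_zone ls a (lend ls j - 1) j = (if snd a ! j = Up then - 1 else 1)"
      using lj by (simp add: exit_zone_def)
    ultimately show ?thesis
      unfolding right_positioned_def using edge
      by (cases "snd a ! j") (auto simp: above_depth_layout[OF assms])
  qed
qed

section \<open>Conflicts in terms of left depth\<close>

text \<open>The later starting line has the larger absolute depth, so its left value alone decides
  the comparison. With equal starts, equal left values give equal left depths and no conflict, while
  different values give opposite nonzero depths.\<close>

lemma conflict_iff_left_depth:
  assumes "is_instance n ls" "j < length ls" "k < length ls"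
  shows "conflict ls X j y k \<longleftrightarrow>
    (if y = Up then left_depth ls X k < left_depth ls X j
     else left_depth ls X j < left_depth ls X k)"
  using instance_line(1)[OF assms(1,2)] instance_line(1)[OF assms(1,3)]
  by (cases y; cases "X ! j"; cases "X ! k") (auto simp: conflict_def left_depth_def)

text \<open>Both lines have the same passing lines at their common end. Moving down from
  \<open>j\<close> to \<open>k\<close> can only add conflicts with \<open>Up\<close> and remove
  conflicts with \<open>Down\<close>, so if \<open>Up\<close> wins for \<open>k\<close> it wins for
  \<open>j\<close>, ties included.\<close>

lemma right_value_mono:
  assumes "is_instance n ls" "j < length ls" "k < length ls" "lend ls j = lend ls k"
    and "left_depth ls X j \<le> left_depth ls X k" and "right_value ls X k = Up"
  shows "right_value ls X j = Up"
proof -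
  have "num_conflicts ls X j Up \<le> num_conflicts ls X k Up"
    "num_conflicts ls X k Down \<le> num_conflicts ls X j Down"
    unfolding num_conflicts_def using assms(4,5)
    by (auto intro!: card_mono
        simp: passing_def conflict_iff_left_depth[OF assms(1,2)] conflict_iff_left_depth[OF assms(1,3)])
  then show ?thesis
    using assms(6) by (auto simp: right_value_def split: if_splits)
qed

section \<open>Counting conflicts and crossings\<close>

text \<open>Pairs are oriented by right ends, the line ending earlier coming first, whereas
  \<open>crossings\<close> orients them by index.\<close>

definition conflict_pairs :: "(nat \<times> nat) list \<Rightarrow> assignment \<Rightarrow> (nat \<times> nat) set" where
  "conflict_pairs ls a =
     (SIGMA j:{..<length ls}. {k \<in> passing ls (lend ls j). conflict ls (fst a) j (snd a ! j) k})"

definition crossings :: "nat \<Rightarrow> (nat \<times> nat) list \<Rightarrow> layout \<Rightarrow> (nat \<times> nat \<times> nat) set" where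
  "crossings n ls lay = (SIGMA i:{1..<n}.
     {(j, k). j \<in> edge_lines ls i \<and> k \<in> edge_lines ls i \<and> j < k \<and> cross_on lay i j k})"

lemma finite_crossing_pairs:
  "finite {(j, k). j \<in> edge_lines ls i \<and> k \<in> edge_lines ls i \<and> P j k}"
  by (rule finite_subset[of _ "edge_lines ls i \<times> edge_lines ls i"]) auto

lemma finite_conflict_pairs [simp]: "finite (conflict_pairs ls a)"
  unfolding conflict_pairs_def by auto

lemma finite_crossings [simp]: "finite (crossings n ls lay)"
  unfolding crossings_def using finite_crossing_pairs by (intro finite_SigmaI) auto

lemma crossing_number_eq_card: "crossing_number n ls lay = card (crossings n ls lay)"
  unfolding crossing_number_def crossings_def
  by (subst card_SigmaI) (use finite_crossing_pairs in auto)

lemma card_conflict_pairs: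
  "card (conflict_pairs ls a) = (\<Sum>j<length ls. num_conflicts ls (fst a) j (snd a ! j))"
  unfolding conflict_pairs_def num_conflicts_def by (subst card_SigmaI) auto

text \<open>For fixed \<open>X\<close>, the conflicts counted for \<open>j\<close> depend on its own
  right value only, so the greedy choice is optimal term by term.\<close>

lemma card_conflict_pairs_complete_assignment_le:
  "card (conflict_pairs ls (complete_assignment ls X)) \<le> card (conflict_pairs ls (X, Y))"
  unfolding card_conflict_pairs
proof (rule sum_mono)
  fix j assume "j \<in> {..<length ls}"
  then show "num_conflicts ls (fst (complete_assignment ls X)) j (snd (complete_assignment ls X) ! j)
      \<le> num_conflicts ls (fst (X, Y)) j (snd (X, Y) ! j)"
    by (cases "Y ! j") (auto simp: complete_assignment_def right_value_def)
qed

section \<open>Upper bound: crossings of the depth layout\<close>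

text \<open>Here \<open>k\<close> enters the edge above \<open>j\<close> and leaves it below. The
  conflict is charged to the line that ends at \<open>i + 1\<close>; the case of two ending lines is
  impossible.\<close>

lemma exit_inversion_imp_conflict:
  assumes inst: "is_instance n ls" and a: "a = complete_assignment ls X"
    and edge: "j \<in> edge_lines ls i" "k \<in> edge_lines ls i"
    and zone: "exit_zone ls a i j < exit_zone ls a i k" and depth: "depth n ls a k < depth n ls a j"
  shows "(j, k) \<in> conflict_pairs ls a \<and> lend ls j = i + 1 \<or>
    (k, j) \<in> conflict_pairs ls a \<and> lend ls k = i + 1"
proof -
  have j: "j < length ls" and k: "k < length ls"
    using edge by (auto simp: edge_lines_def)
  note lj = instance_line[OF inst j] and lk = instance_line[OF inst k]
  have ld: "left_depth ls X k \<le> left_depth ls X j"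
    using depth by (auto simp: depth_def a complete_assignment_def)
  have fst_a: "fst a = X" by (simp add: a complete_assignment_def)
  have snd_a: "snd a ! l = right_value ls X l" if "l < length ls" for l
    using that by (simp add: a complete_assignment_def)
  show ?thesis
  proof (cases "lend ls j = i + 1 \<and> lend ls k = i + 1")
    case True
    then have "snd a ! j = Up" "snd a ! k = Down"
      using zone by (auto simp: exit_zone_def split: if_splits intro: side.exhaust)
    \<comment> \<open>By monotonicity, \<open>Up\<close> for the deeper line \<open>j\<close> forces
      \<open>Up\<close> for \<open>k\<close>, contradicting \<open>Down\<close>.\<close>
    then show ?thesis
      using right_value_mono[OF inst k j _ ld] True snd_a[OF j] snd_a[OF k] by simp
  next
    case False
    then consider "lend ls j = i + 1" "lend ls k \<noteq> i + 1" "snd a ! j = Up"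
      | "lend ls k = i + 1" "lend ls j \<noteq> i + 1" "snd a ! k = Down"
      using zone by (cases "snd a ! k") (auto simp: exit_zone_def split: if_splits)
    then show ?thesis
    proof cases
      case 1
      then have pass: "k \<in> passing ls (lend ls j)"
        using edge k by (auto simp: passing_def edge_lines_def)
      \<comment> \<open>The tie-break already favours \<open>j\<close>, so the inversion of depths
        must come from a strict inequality of left depths.\<close>
      have "right_depth n ls (snd a) j < right_depth n ls (snd a) k"
        using 1 pass lk by (auto simp: right_depth_def passing_def)
      then have "left_depth ls X k < left_depth ls X j"
        using depth by (auto simp: depth_def fst_a)
      then have "conflict ls X j (snd a ! j) k"
        using 1 by (simp add: conflict_iff_left_depth[OF inst j k])
      then show ?thesis
        using 1 pass j by (simp add: conflict_pairs_def fst_a)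
    next
      case 2
      then have pass: "j \<in> passing ls (lend ls k)"
        using edge j by (auto simp: passing_def edge_lines_def)
      have "right_depth n ls (snd a) j < right_depth n ls (snd a) k"
        using 2 pass lj by (auto simp: right_depth_def passing_def)
      then have "left_depth ls X k < left_depth ls X j"
        using depth by (auto simp: depth_def fst_a)
      then have "conflict ls X k (snd a ! k) j"
        using 2 by (simp add: conflict_iff_left_depth[OF inst k j])
      then show ?thesis
        using 2 pass k by (simp add: conflict_pairs_def fst_a)
    qed
  qed
qed

lemma crossing_number_depth_layout_le:
  assumes inst: "is_instance n ls" and a: "a = complete_assignment ls X"
  shows "crossing_number n ls (depth_layout n ls a) \<le> card (conflict_pairs ls a)"
proof -
  have ex: "(j, k) \<in> conflict_pairs ls a \<and> lend ls j = i + 1 \<or>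
      (k, j) \<in> conflict_pairs ls a \<and> lend ls k = i + 1"
    if "(i, j, k) \<in> crossings n ls (depth_layout n ls a)" for i j k
  proof -
    have jk: "j \<in> edge_lines ls i" "k \<in> edge_lines ls i" "j \<noteq> k"
      and cr: "cross_on (depth_layout n ls a) i j k"
      using that by (auto simp: crossings_def)
    have "depth n ls a j \<noteq> depth n ls a k"
      using inj_on_depth[OF inst, of a] jk by (auto simp: inj_on_def edge_lines_def)
    \<comment> \<open>The left end compares depths and the right end compares zones first, so a
      crossing requires zones ordered strictly against depths.\<close>
    then have "exit_zone ls a i j < exit_zone ls a i k \<and> depth n ls a k < depth n ls a j \<or>
        exit_zone ls a i k < exit_zone ls a i j \<and> depth n ls a j < depth n ls a k"
      using cr jk unfolding cross_on_def above_depth_layout[OF inst] less_prod_simp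
      by (meson linorder_less_linear not_less order_less_imp_le)
    then show ?thesis
      using exit_inversion_imp_conflict[OF inst a jk(1,2)] exit_inversion_imp_conflict[OF inst a jk(2,1)]
      by blast
  qed
  \<comment> \<open>The first line of the image ends at \<open>i + 1\<close>, so the edge can be
    recovered from the image; the order of the two indices is recovered from \<open>j < k\<close>.
    Hence \<open>f\<close> is injective.\<close>
  define f where "f = (\<lambda>(i, j, k). if (j, k) \<in> conflict_pairs ls a \<and> lend ls j = i + 1
    then (j, k) else (k, j))"
  have *: "f (i, j, k) \<in> conflict_pairs ls a \<and> lend ls (fst (f (i, j, k))) = i + 1"
    if "(i, j, k) \<in> crossings n ls (depth_layout n ls a)" for i j k
    using ex[OF that] unfolding f_def by auto
  have f_cases: "f (i, j, k) = (j, k) \<or> f (i, j, k) = (k, j)" for i j k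
    unfolding f_def by auto
  have "inj_on f (crossings n ls (depth_layout n ls a))"
  proof (rule inj_onI)
    fix x x'
    assume x: "x \<in> crossings n ls (depth_layout n ls a)"
      "x' \<in> crossings n ls (depth_layout n ls a)" "f x = f x'"
    obtain i j k i' j' k' where x_eq: "x = (i, j, k)" "x' = (i', j', k')"
      by (metis prod_cases3)
    then have c: "(i, j, k) \<in> crossings n ls (depth_layout n ls a)"
      and c': "(i', j', k') \<in> crossings n ls (depth_layout n ls a)"
      and eq: "f (i, j, k) = f (i', j', k')"
      using x by auto
    have "i = i'" using *[OF c] *[OF c'] eq by simp
    moreover have "j < k" "j' < k'" using c c' by (auto simp: crossings_def)
    ultimately show "x = x'"
      using x_eq eq f_cases[of i j k] f_cases[of i' j' k'] by auto
  qed
  then show ?thesis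
    unfolding crossing_number_eq_card using * by (intro card_inj_on_le[of f]) auto
qed

section \<open>Lower bound: conflicts force crossings\<close>

text \<open>Admissibility carries the relative order unchanged across each station between edges
  \<open>p\<close> and \<open>q\<close>, so a change between the outer ends must occur on some
  edge.\<close>

lemma ex_cross_on:
  assumes adm: "admissible n ls lay" and "1 \<le> p" "p \<le> q" "q < n"
    and range: "\<And>i. p < i \<Longrightarrow> i \<le> q \<Longrightarrow> j \<in> passing ls i \<and> k \<in> passing ls i"
    and diff: "above (at_left lay p) j k \<noteq> above (at_right lay q) j k"
  shows "\<exists>i\<in>{p..q}. cross_on lay i j k"
proof (rule ccontr)
  assume nc: "\<not> ?thesis"
  have "above (at_left lay p) j k \<longleftrightarrow> above (at_right lay (p + d)) j k" if "p + d \<le> q" for d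
    using that
  proof (induction d)
    case 0
    then show ?case using nc assms(3) by (auto simp: cross_on_def)
  next
    case (Suc d)
    have "above (at_right lay (p + d)) j k \<longleftrightarrow> above (at_left lay (p + Suc d)) j k"
      using adm range[of "p + Suc d"] Suc.prems assms(2,4)
      by (force simp: admissible_def)
    moreover have "\<not> cross_on lay (p + Suc d) j k"
      using nc Suc.prems by auto
    ultimately show ?case
      using Suc by (simp add: cross_on_def)
  qed
  from this[of "q - p"] show False
    using diff assms(3) by simp
qed

text \<open>The left values fix the order where the common part of the two lines begins, the right
  value of \<open>j\<close> fixes it where \<open>j\<close> ends, and a conflict says that the two
  disagree. The assumption \<open>forced\<close> serves equal starts: a line with value
  \<open>Down\<close> then supplies a passing line that separates the two.\<close>

lemma conflict_imp_cross_on: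
  assumes inst: "is_instance n ls" and adm: "admissible n ls lay"
    and real: "realizes ls lay (X, Y)"
    and forced: "\<And>j. j < length ls \<Longrightarrow> X ! j = Down \<Longrightarrow> passing ls (lstart ls j) \<noteq> {}"
    and conf: "(j, k) \<in> conflict_pairs ls (X, Y)"
  shows "\<exists>i. i \<in> {1..<n} \<and> j \<in> edge_lines ls i \<and> k \<in> edge_lines ls i \<and> cross_on lay i j k"
proof -
  have j: "j < length ls" and k: "k < length ls" and pass: "k \<in> passing ls (lend ls j)"
    and c: "conflict ls X j (Y ! j) k"
    using conf by (auto simp: conflict_pairs_def passing_def)
  note lj = instance_line[OF inst j] and lk = instance_line[OF inst k]
  have ends: "lstart ls k < lend ls j" "lend ls j < lend ls k"
    using pass by (auto simp: passing_def)
  then have "j \<noteq> k" by auto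
  \<comment> \<open>The first and last common edges; edge \<open>q\<close> ends at the station where
    \<open>j\<close> ends.\<close>
  define p q where "p = max (lstart ls j) (lstart ls k)" and "q = lend ls j - 1"
  have pq: "1 \<le> p" "p \<le> q" "q < n"
    using lj lk ends by (auto simp: p_def q_def)
  have edge: "j \<in> edge_lines ls i" "k \<in> edge_lines ls i" if "p \<le> i" "i \<le> q" for i
    using that j k ends lj by (auto simp: edge_lines_def p_def q_def)
  have lay: "distinct (at_left lay i)" "set (at_left lay i) = edge_lines ls i"
    "distinct (at_right lay i)" "set (at_right lay i) = edge_lines ls i" if "p \<le> i" "i \<le> q" for i
    using that adm pq by (auto simp: admissible_def is_layout_def)
  have notl: "\<not> above (at_left lay p) j k \<longleftrightarrow> above (at_left lay p) k j"
    and notr: "\<not> above (at_right lay q) j k \<longleftrightarrow> above (at_right lay q) k j"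
    using lay[of p] lay[of q] edge[of p] edge[of q] pq \<open>j \<noteq> k\<close> by (auto simp: not_above_iff)
  have left: "left_positioned ls lay l (X ! l)" if "l < length ls" for l
    using real that by (simp add: realizes_def)
  have leftU: "above (at_left lay (lstart ls l)) l m"
    if "l < length ls" "X ! l = Up" "m \<in> passing ls (lstart ls l)" for l m
    using left[OF that(1)] that by (simp add: left_positioned_def)
  have leftD: "above (at_left lay (lstart ls l)) m l"
    if "l < length ls" "X ! l = Down" "m \<in> passing ls (lstart ls l)" for l m
    using left[OF that(1)] that by (simp add: left_positioned_def)
  have right: "above (at_right lay q) j k \<longleftrightarrow> Y ! j = Up"
  proof -
    have "right_positioned ls lay j (Y ! j)"
      using real j by (simp add: realizes_def)
    then show ?thesis
      using pass notr by (cases "Y ! j") (auto simp: right_positioned_def q_def)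
  qed
  have diff: "above (at_left lay p) j k \<longleftrightarrow> Y ! j \<noteq> Up"
  proof (cases "lstart ls j" "lstart ls k" rule: linorder_cases)
    case less
    then have "j \<in> passing ls (lstart ls k)" "p = lstart ls k"
      using j ends by (auto simp: passing_def p_def)
    then show ?thesis
      using less c leftU[OF k] leftD[OF k] notl by (cases "X ! k") (auto simp: conflict_def)
  next
    case greater
    then have "k \<in> passing ls (lstart ls j)" "p = lstart ls j"
      using k ends lj by (auto simp: passing_def p_def)
    then show ?thesis
      using greater c leftU[OF j] leftD[OF j] notl
      by (cases "X ! j"; cases "Y ! j") (auto simp: conflict_def)
  next
    case equal
    then have p: "lstart ls j = p" "lstart ls k = p" by (auto simp: p_def)
    have ne: "X ! j \<noteq> Y ! j" "X ! k = Y ! j"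
      using c equal by (auto simp: conflict_def)
    \<comment> \<open>Neither line passes through the common left end; they are separated by a line that does.\<close>
    then have "passing ls p \<noteq> {}"
      using forced[OF j] forced[OF k] p by (cases "X ! j"; cases "X ! k") auto
    then obtain l where l: "l \<in> passing ls p" by auto
    show ?thesis
    proof (cases "Y ! j")
      case Up
      then have "X ! j = Down" "X ! k = Up"
        using ne by (cases "X ! j"; auto)+
      then have "above (at_left lay p) k j"
        using above_trans[OF lay(1)[of p], of k l j] leftU[OF k, of l] leftD[OF j, of l] l p pq
        by simp
      then show ?thesis using Up notl by auto
    next
      case Down
      then have "X ! j = Up" "X ! k = Down"
        using ne by (cases "X ! j"; auto)+
      then have "above (at_left lay p) j k"
        using above_trans[OF lay(1)[of p], of j l k] leftU[OF j, of l] leftD[OF k, of l] l p pq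
        by simp
      then show ?thesis using Down by auto
    qed
  qed
  have "j \<in> passing ls i \<and> k \<in> passing ls i" if "p < i" "i \<le> q" for i
    using that j k ends by (auto simp: passing_def p_def q_def)
  then obtain i where "i \<in> {p..q}" "cross_on lay i j k"
    using ex_cross_on[OF adm pq, of j k] diff right by blast
  then show ?thesis
    using edge[of i] pq by (intro exI[of _ i]) auto
qed

lemma cross_on_commute:
  assumes "is_layout n ls lay" "i \<in> {1..<n}" "j \<in> edge_lines ls i" "k \<in> edge_lines ls i" "j \<noteq> k"
  shows "cross_on lay i j k \<longleftrightarrow> cross_on lay i k j"
proof -
  have "\<not> above (at_left lay i) j k \<longleftrightarrow> above (at_left lay i) k j"
    "\<not> above (at_right lay i) j k \<longleftrightarrow> above (at_right lay i) k j"
    using assms by (simp_all add: is_layout_def not_above_iff)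
  then show ?thesis
    unfolding cross_on_def by blast
qed

lemma card_conflict_pairs_le_crossing_number:
  assumes inst: "is_instance n ls" and adm: "admissible n ls lay"
    and real: "realizes ls lay (X, Y)"
    and forced: "\<And>j. j < length ls \<Longrightarrow> X ! j = Down \<Longrightarrow> passing ls (lstart ls j) \<noteq> {}"
  shows "card (conflict_pairs ls (X, Y)) \<le> crossing_number n ls lay"
proof -
  let ?C = "conflict_pairs ls (X, Y)"
  have "\<forall>(j, k) \<in> ?C. \<exists>i. i \<in> {1..<n} \<and> j \<in> edge_lines ls i \<and> k \<in> edge_lines ls i \<and>
      cross_on lay i j k"
    using conflict_imp_cross_on[OF inst adm real forced] by blast
  then obtain e where "\<forall>x \<in> ?C. case x of (j, k) \<Rightarrow> e x \<in> {1..<n} \<and>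
      j \<in> edge_lines ls (e x) \<and> k \<in> edge_lines ls (e x) \<and> cross_on lay (e x) j k"
    unfolding case_prod_beta by (rule bchoice[THEN exE])
  then have e: "e (j, k) \<in> {1..<n} \<and> j \<in> edge_lines ls (e (j, k)) \<and>
      k \<in> edge_lines ls (e (j, k)) \<and> cross_on lay (e (j, k)) j k" if "(j, k) \<in> ?C" for j k
    using that by blast
  have ends: "lend ls j < lend ls k" if "(j, k) \<in> ?C" for j k
    using that by (auto simp: conflict_pairs_def passing_def)
  \<comment> \<open>Reordering by index loses no information, because only one orientation of a pair
    has increasing right ends.\<close>
  define f where "f = (\<lambda>(j, k). (e (j, k), min j k, max j k))"
  have "inj_on f ?C"
  proof (rule inj_onI)
    fix x x' assume "x \<in> ?C" "x' \<in> ?C" "f x = f x'"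
    then show "x = x'"
      using ends[of "fst x" "snd x"] ends[of "fst x'" "snd x'"]
      by (cases x; cases x') (auto simp: f_def min_def max_def split: if_splits)
  qed
  moreover have "f ` ?C \<subseteq> crossings n ls lay"
  proof (rule image_subsetI)
    fix x assume "x \<in> ?C"
    then obtain j k where x: "x = (j, k)" and jk: "(j, k) \<in> ?C"
      by (cases x) auto
    have "j \<noteq> k" using ends[OF jk] by auto
    moreover have "is_layout n ls lay" using adm by (simp add: admissible_def)
    ultimately show "f x \<in> crossings n ls lay"
      using x e[OF jk] cross_on_commute[of n ls lay "e (j, k)" j k]
      by (auto simp: f_def crossings_def min_def max_def)
  qed
  ultimately show ?thesis
    unfolding crossing_number_eq_card by (intro card_inj_on_le[of f]) auto
qed

section \<open>Comparison with the optimum\<close>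

lemma complete_assignment_no_worse:
  assumes inst: "is_instance n ls" and adm: "admissible n ls lay" and per: "periphery ls lay"
  obtains X where "length X = length ls"
    and "min_crossings_realizing n ls (complete_assignment ls X) \<le> crossing_number n ls lay"
proof
  define X where
    "X = map (\<lambda>j. if left_positioned ls lay j Up then Up else Down) [0..<length ls]"
  define Y where
    "Y = map (\<lambda>j. if right_positioned ls lay j Up then Up else Down) [0..<length ls]"
  show "length X = length ls" by (simp add: X_def)
  have "realizes ls lay (X, Y)"
    using per by (auto simp: realizes_def periphery_def X_def Y_def)
  \<comment> \<open>\<open>Down\<close> is chosen only where \<open>Up\<close> fails, and
    \<open>Up\<close> holds vacuously if no line passes through the left end.\<close>
  moreover have "passing ls (lstart ls j) \<noteq> {}" if "j < length ls" "X ! j = Down" for j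
    using that by (auto simp: X_def left_positioned_def split: if_splits)
  ultimately have "card (conflict_pairs ls (X, Y)) \<le> crossing_number n ls lay"
    using card_conflict_pairs_le_crossing_number[OF inst adm] by blast
  moreover have "min_crossings_realizing n ls (complete_assignment ls X)
      \<le> crossing_number n ls (depth_layout n ls (complete_assignment ls X))"
    unfolding min_crossings_realizing_def
    by (rule Least_le) (use admissible_depth_layout[OF inst] realizes_depth_layout[OF inst] in blast)
  ultimately show "min_crossings_realizing n ls (complete_assignment ls X)
      \<le> crossing_number n ls lay"
    using crossing_number_depth_layout_le[OF inst refl, of X]
      card_conflict_pairs_complete_assignment_le[of ls X Y] by linarith
qed

lemma realizes_imp_periphery:
  assumes "realizes ls lay a"
  shows "periphery ls lay"
  unfolding periphery_def
proof (intro allI impI)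
  fix j assume "j < length ls"
  then have "left_positioned ls lay j (fst a ! j)" "right_positioned ls lay j (snd a ! j)"
    using assms by (auto simp: realizes_def)
  then show "(left_positioned ls lay j Up \<or> left_positioned ls lay j Down) \<and>
      (right_positioned ls lay j Up \<or> right_positioned ls lay j Down)"
    by (cases "fst a ! j"; cases "snd a ! j") simp_all
qed

text \<open>Every assignment is realized by its depth layout, so the \<open>LEAST\<close> on the
  right is attained, and by a layout that competes in the optimum.\<close>

lemma optimum_le_min_crossings_realizing:
  assumes "is_instance n ls"
  shows "mlcm_p_path_optimum n ls \<le> min_crossings_realizing n ls a"
proof -
  have "\<exists>c lay. admissible n ls lay \<and> realizes ls lay a \<and> crossing_number n ls lay = c"
    using admissible_depth_layout[OF assms] realizes_depth_layout[OF assms] by blast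
  from LeastI_ex[OF this] show ?thesis
    unfolding mlcm_p_path_optimum_def min_crossings_realizing_def
    by (intro Least_le) (blast intro: realizes_imp_periphery)
qed

lemma optimum_attained:
  assumes "is_instance n ls"
  obtains lay where "admissible n ls lay" "periphery ls lay"
    "crossing_number n ls lay = mlcm_p_path_optimum n ls"
proof -
  have "\<exists>c lay. admissible n ls lay \<and> periphery ls lay \<and> crossing_number n ls lay = c"
    using admissible_depth_layout[OF assms] realizes_depth_layout[OF assms] realizes_imp_periphery
    by blast
  from LeastI_ex[OF this] show ?thesis
    using that unfolding mlcm_p_path_optimum_def by blast
qed

theorem theorem2:
  fixes n :: nat and ls :: "(nat \<times> nat) list" and Xs :: "side list list"
  assumes "is_instance n ls"
    and "distinct Xs" and "set Xs = {X. length X = length ls}"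
  shows "(\<exists>lay. admissible n ls lay \<and> realizes ls lay (fix_left_end n ls Xs)) \<and>
         min_crossings_realizing n ls (fix_left_end n ls Xs) = mlcm_p_path_optimum n ls"
proof
  \<comment> \<open>This conjunct ensures that the \<open>LEAST\<close> in the second one ranges
    over a nonempty set.\<close>
  show "\<exists>lay. admissible n ls lay \<and> realizes ls lay (fix_left_end n ls Xs)"
    using admissible_depth_layout[OF assms(1)] realizes_depth_layout[OF assms(1)] by blast
  obtain lay where lay: "admissible n ls lay" "periphery ls lay"
    "crossing_number n ls lay = mlcm_p_path_optimum n ls"
    using optimum_attained[OF assms(1)] .
  obtain X where X: "length X = length ls"
    "min_crossings_realizing n ls (complete_assignment ls X) \<le> mlcm_p_path_optimum n ls"
    using complete_assignment_no_worse[OF assms(1) lay(1,2)] lay(3) by metis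
  \<comment> \<open>Membership also shows that \<open>Xs\<close> is nonempty, as needed for
    \<open>arg_min_list\<close> to attain the minimum.\<close>
  have mem: "X \<in> set Xs" using X(1) assms(3) by simp
  then have "min_crossings_realizing n ls (fix_left_end n ls Xs)
      = Min (min_crossings_realizing n ls ` set (map (complete_assignment ls) Xs))"
    unfolding fix_left_end_def by (intro f_arg_min_list_f) auto
  also have "\<dots> \<le> min_crossings_realizing n ls (complete_assignment ls X)"
    using mem by (intro Min_le) auto
  finally show "min_crossings_realizing n ls (fix_left_end n ls Xs) = mlcm_p_path_optimum n ls"
    using X(2) optimum_le_min_crossings_realizing[OF assms(1)] by (meson le_antisym order_trans)
qed

end
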